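(* Let $\gamma\subset\mathbf{C}^n\subset\mathbf{P}^n$ be a connected closed curve, let $z_0\in\mathbf{C}^n\setminus\gamma$, and let $\{f_r\}_r$ be a family of analytic maps $f_r:\Delta\to\mathbf{P}^n$, indexed by numbers $r>0$ converging to $0$, such that: (i) $f_r(\partial\Delta)\subset K_r$ for all $r$; (ii) $f_r(0)=z_0$ for all $r$; (iii) there is a number $M>0$, independent of $r$, such that for all $r$ the poles $\zeta^{(r)}_1,\dots,\zeta^{(r)}_{N_r}$ of $f_r$ in $\Delta$ satisfy $\sum_{j=1}^{N_r}\log|\zeta^{(r)}_j|\ge -M$; (iv) for all $r$ and $j$, the $\mathbf{C}^n$-valued function $(\zeta-\zeta^{(r)}_j)f_r(\zeta)$ is holomorphic in a neighborhood of $\zeta^{(r)}_j$. Put $$B_r(\zeta)=\prod_{j=1}^{N_r}\left(\frac{\zeta-\zeta^{(r)}_j}{1-\overline{\zeta}^{(r)}_j\,\zeta}\right)\quad(\zeta\in\Delta),\qquad G_r=f_r\cdot B_r .$$ Let $r_j\to0$ be a sequence of indices such that, as $j\to\infty$, $G_{r_j}$ converges pointwise on $\operatorname{Int}\Delta$ to a holomorphic ($\mathbf{C}^n$-valued) function $G$ and $B_{r_j}$ converges pointwise on $\operatorname{Int}\Delta$ to a holomorphic function $B$, and set $f=G/B$, regarded as a holomorphic map $f:\operatorname{Int}\Delta\to\mathbf{P}^n$. Then $$f(\operatorname{Int}\Delta)\subset\widehat{\gamma}.$$ In particular, $f(0)=z_0\in\widehat{\gamma}$.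
   Context: Write $\mathbf{P}^n=\mathbf{C}^n\cup H$, where $\mathbf{P}^n$ is complex projective $n$-space and $H$ is the hyperplane at infinity. $\Delta$ is the closed unit disk in $\mathbf{C}$, $\operatorname{Int}\Delta$ its interior, $\partial\Delta$ its boundary circle; an analytic map $f:\Delta\to\mathbf{P}^n$ is a map holomorphic in a neighborhood of $\Delta$. The curve $\gamma$ is compact. For $r>0$, $K_r=\{z\in\mathbf{C}^n:\operatorname{dist}(z,\gamma)<r\}$. The poles of an analytic map $f:\Delta\to\mathbf{P}^n$ (viewed as a $\mathbf{C}^n$-valued meromorphic function) are the points $\zeta\in\Delta$ with $f(\zeta)\in H$; under condition (i) they are finitely many interior points. By (iv), $G_r$ has no poles on $\Delta$. Condition (iii) gives $|B_r(0)|\ge e^{-M}$ for all $r$, so $B\not\equiv0$ and $f=G/B$ is a well-defined $\mathbf{C}^n$-valued meromorphic function on $\operatorname{Int}\Delta$; such a function extends uniquely across its poles to a holomorphic map $\operatorname{Int}\Delta\to\mathbf{P}^n$. The $G_r$ and $B_r$ form normal families on $\operatorname{Int}\Delta$, so sequences $r_j$ as in the claim exist. Projective hull: for a compact set $\gamma\subset\mathbf{P}^n$, $\widehat{\gamma}$ is the set of points $x\in\mathbf{P}^n$ for which there is a constant $C=C(x)>0$ such that $\|\mathcal{P}(x)\|\le C^d\sup_\gamma\|\mathcal{P}\|$ for all $d\ge1$ and all holomorphic sections $\mathcal{P}\in H^0(\mathbf{P}^n,\mathcal{O}(d))$, where $\|\cdot\|$ is the standard (Fubini–Study) metric on $\mathcal{O}(d)$.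 When $\gamma\subset\mathbf{C}^n$, a point $z\in\mathbf{C}^n$ lies in $\widehat\gamma$ if and only if there is a constant $C>0$ with $|P(z)|\le C^d\sup_\gamma|P|$ for all $d\geq 1$ and all polynomials $P$ on $\mathbf{C}^n$ of degree $\le d$. *)

theory Defs
  imports "HOL-Complex_Analysis.Complex_Analysis"
begin

unbundle no fps_syntax

text \<open>Homogeneous coordinates live in \<open>\<complex> \<times> \<complex>\<^sup>n\<close>, whose library norm is the Euclidean norm of
  \<open>\<complex>\<^sup>n\<^sup>+\<^sup>1\<close>; the first component is the homogenizing coordinate.\<close>

definition cscale :: "complex \<Rightarrow> complex \<times> (complex ^ 'n) \<Rightarrow> complex \<times> (complex ^ 'n)" where
  "cscale c v = (c * fst v, c *s snd v)"

definition projrel :: "complex \<times> (complex ^ 'n::finite) \<Rightarrow> complex \<times> (complex ^ 'n) \<Rightarrow> bool" where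
  "projrel v w \<longleftrightarrow> v \<noteq> 0 \<and> w \<noteq> 0 \<and> (\<exists>c. c \<noteq> 0 \<and> w = cscale c v)"

lemma projrel_part_equivp: "part_equivp (projrel :: complex \<times> (complex ^ 'n::finite) \<Rightarrow> _)"
proof (rule part_equivpI)
  have "projrel (1, 0) ((1, 0) :: complex \<times> (complex ^ 'n))"
    unfolding projrel_def by (auto simp: cscale_def prod_eq_iff intro!: exI[of _ 1])
  then show "\<exists>x :: complex \<times> (complex ^ 'n). projrel x x" by blast
  show "symp (projrel :: complex \<times> (complex ^ 'n) \<Rightarrow> _)"
  proof (rule sympI)
    fix v w :: "complex \<times> (complex ^ 'n)"
    assume "projrel v w"
    then obtain c where c: "v \<noteq> 0" "w \<noteq> 0" "c \<noteq> 0" "w = cscale c v"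
      unfolding projrel_def by blast
    then have "v = cscale (inverse c) w"
      by (simp add: cscale_def prod_eq_iff flip: mult.assoc)
    with c show "projrel w v"
      unfolding projrel_def using nonzero_imp_inverse_nonzero by blast
  qed
  show "transp (projrel :: complex \<times> (complex ^ 'n) \<Rightarrow> _)"
  proof (rule transpI)
    fix u v w :: "complex \<times> (complex ^ 'n)"
    assume "projrel u v" "projrel v w"
    then obtain c d where cd: "u \<noteq> 0" "w \<noteq> 0" "c \<noteq> 0" "d \<noteq> 0" "v = cscale c u" "w = cscale d v"
      unfolding projrel_def by blast
    then have "w = cscale (d * c) u"
      by (simp add: cscale_def mult.assoc)
    with cd show "projrel u w"
      unfolding projrel_def using no_zero_divisors by blast
  qed
qed

text \<open>Complex projective space \<open>P\<^sup>n\<close>, where \<open>n\<close> is the cardinality of \<open>'n\<close>; \<open>abs_cproj v\<close> is the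
  point with homogeneous coordinates \<open>v\<close>, meaningful for \<open>v \<noteq> 0\<close>.\<close>

quotient_type (overloaded) 'n cproj = "complex \<times> (complex ^ 'n::finite)" / partial: projrel
  by (rule projrel_part_equivp)

definition of_affine :: "complex ^ 'n::finite \<Rightarrow> 'n cproj" where
  "of_affine z = abs_cproj (1, z)"

definition hyperplane_infinity :: "'n::finite cproj set" where
  "hyperplane_infinity = {abs_cproj (0, w) | w. w \<noteq> 0}"

text \<open>Unspecified at points of the hyperplane at infinity.\<close>

definition affine_coord :: "'n::finite cproj \<Rightarrow> complex ^ 'n" where
  "affine_coord p = (THE z. p = of_affine z)"

definition vec_analytic_on :: "(complex \<Rightarrow> complex ^ 'n) \<Rightarrow> complex set \<Rightarrow> bool" where
  "vec_analytic_on g S \<longleftrightarrow> (\<forall>i. (\<lambda>w. g w $ i) analytic_on S)"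

text \<open>Like \<^const>\<open>analytic_on\<close>, this means holomorphic in a neighbourhood of \<open>S\<close> (so simply
  holomorphic on \<open>S\<close> if \<open>S\<close> is open). Holomorphy of a map into \<open>P\<^sup>n\<close> is that of its local
  homogeneous coordinates.\<close>

definition proj_analytic_on :: "(complex \<Rightarrow> 'n::finite cproj) \<Rightarrow> complex set \<Rightarrow> bool" where
  "proj_analytic_on f S \<longleftrightarrow>
     (\<forall>\<zeta>\<in>S. \<exists>V a g. open V \<and> \<zeta> \<in> V \<and> a analytic_on V \<and> vec_analytic_on g V \<and>
        (\<forall>w\<in>V. (a w, g w) \<noteq> 0 \<and> f w = abs_cproj (a w, g w)))"

text \<open>Holomorphic sections of \<open>\<O>(d)\<close>, as functions on the complement of the origin in \<open>\<complex>\<^sup>n\<^sup>+\<^sup>1\<close>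
  that are holomorphic and homogeneous of degree \<open>d\<close>; the value at \<open>0\<close> is irrelevant.\<close>

definition holomorphic_section :: "nat \<Rightarrow> (complex \<times> (complex ^ 'n::finite) \<Rightarrow> complex) \<Rightarrow> bool" where
  "holomorphic_section d F \<longleftrightarrow>
     (\<forall>v. v \<noteq> 0 \<longrightarrow>
        (\<exists>D. (F has_derivative D) (at v) \<and> (\<forall>c u. D (cscale c u) = c * D u))) \<and>
     (\<forall>c v. c \<noteq> 0 \<longrightarrow> v \<noteq> 0 \<longrightarrow> F (cscale c v) = c ^ d * F v)"

text \<open>The Fubini-Study norm of a section of \<open>\<O>(d)\<close> at a point. By homogeneity the choice of the
  representative does not matter, see \<open>fs_norm_abs_cproj\<close> below.\<close>

definition fs_norm ::
  "nat \<Rightarrow> (complex \<times> (complex ^ 'n::finite) \<Rightarrow> complex) \<Rightarrow> 'n cproj \<Rightarrow> real" where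
  "fs_norm d F p = norm (F (rep_cproj p)) / norm (rep_cproj p) ^ d"

lemma norm_cscale: "norm (cscale c v) = norm c * norm (v :: complex \<times> (complex ^ 'n::finite))"
proof -
  have *: "norm (c *s z) = norm c * norm z" for z :: "complex ^ 'n"
    by (simp add: norm_vec_def norm_mult L2_set_right_distrib)
  have "norm (cscale c v) = sqrt ((norm c)\<^sup>2 * ((norm (fst v))\<^sup>2 + (norm (snd v))\<^sup>2))"
    by (simp add: cscale_def norm_prod_def * norm_mult power_mult_distrib distrib_left)
  then show ?thesis
    by (simp add: norm_prod_def real_sqrt_mult)
qed

lemma fs_norm_abs_cproj:
  fixes v :: "complex \<times> (complex ^ 'n::finite)"
  assumes "holomorphic_section d F" "v \<noteq> 0"
  shows "fs_norm d F (abs_cproj v) = norm (F v) / norm v ^ d"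
proof -
  have "cscale 1 v = v"
    by (simp add: cscale_def)
  then have "projrel v v"
    unfolding projrel_def using assms(2) by (intro conjI exI[of _ 1]) simp_all
  then have "projrel v (rep_cproj (abs_cproj v))"
    by (rule rep_abs_rsp[OF Quotient3_cproj])
  then obtain c where c: "c \<noteq> 0" "rep_cproj (abs_cproj v) = cscale c v"
    unfolding projrel_def by blast
  have "F (cscale c v) = c ^ d * F v"
    using assms c(1) unfolding holomorphic_section_def by blast
  with c show ?thesis
    by (simp add: fs_norm_def norm_cscale norm_mult norm_power power_mult_distrib)
qed

text \<open>Intended for nonempty compact \<open>A\<close>, where the supremum is that of a bounded set of reals.\<close>

definition projective_hull :: "'n::finite cproj set \<Rightarrow> 'n cproj set" where
  "projective_hull A =
     {x. \<exists>C>0. \<forall>d\<ge>1. \<forall>F. holomorphic_section d F \<longrightarrow>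
           fs_norm d F x \<le> C ^ d * (SUP y\<in>A. fs_norm d F y)}"

definition curve_nbhd :: "(complex ^ 'n::finite) set \<Rightarrow> real \<Rightarrow> (complex ^ 'n) set" where
  "curve_nbhd \<gamma> r = {z. infdist z \<gamma> < r}"

text \<open>A finite set if \<open>f\<close> is analytic on the closed disk and maps the unit circle into affine
  space. Multiplicities are not recorded: only maps with simple poles are considered.\<close>

definition poles :: "(complex \<Rightarrow> 'n::finite cproj) \<Rightarrow> complex set" where
  "poles f = {\<zeta> \<in> cball 0 1. f \<zeta> \<in> hyperplane_infinity}"

text \<open>The affine vector-valued function \<open>(w - \<zeta>) f(w)\<close> is understood to be extended to \<open>\<zeta>\<close> itself
  by removing the singularity there.\<close>

definition at_most_simple_pole :: "(complex \<Rightarrow> 'n::finite cproj) \<Rightarrow> complex \<Rightarrow> bool" where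
  "at_most_simple_pole f \<zeta> \<longleftrightarrow>
     (\<exists>g. vec_analytic_on g {\<zeta>} \<and> (\<forall>\<^sub>F w in at \<zeta>. g w = (w - \<zeta>) *s affine_coord (f w)))"

definition blaschke :: "(complex \<Rightarrow> 'n::finite cproj) \<Rightarrow> complex \<Rightarrow> complex" where
  "blaschke f \<zeta> = (\<Prod>p\<in>poles f. (\<zeta> - p) / (1 - cnj p * \<zeta>))"

text \<open>The product of \<open>f\<close>, as a vector-valued meromorphic function, with its Blaschke product; its
  values at the poles of \<open>f\<close> are the limits there.\<close>

definition pole_cleared :: "(complex \<Rightarrow> 'n::finite cproj) \<Rightarrow> complex \<Rightarrow> complex ^ 'n" where
  "pole_cleared f \<zeta> = (\<chi> i. remove_sings (\<lambda>w. blaschke f w * affine_coord (f w) $ i) \<zeta>)"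

end

theory Submission
  imports Defs
begin

unbundle no fps_syntax

text \<open>Let \<open>F\<close> be a section of \<open>\<O>(d)\<close>, regarded as a homogeneous function on the complement of the
  origin in \<open>\<complex>\<^sup>n\<^sup>+\<^sup>1\<close>. For a disk \<open>f\<close> with simple poles, the Blaschke product \<open>b\<close> of the poles and the
  cleared function \<open>g = b f\<close> are homogeneous coordinates \<open>(b, g)\<close> of \<open>f\<close>: they are holomorphic near
  the closed disk and, because the poles are simple, have no common zero
  (\<open>cleared_coordinates\<close>). So \<open>F (b, g)\<close> is holomorphic. As \<open>b\<close> has modulus 1 on the circle, the
  maximum principle bounds \<open>F (b, g)\<close> on the disk by the maximum of \<open>F (1, z)\<close> over the boundary
  values \<open>z\<close> of \<open>f\<close> (\<open>section_bound\<close>). These boundary values accumulate only on \<open>\<gamma>\<close>, so in the limit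
  \<open>\<bar>F (B, G)\<bar> \<le> sup\<^bsub>\<gamma>\<^esub> \<bar>F (1, z)\<bar>\<close> wherever \<open>(B, G) \<noteq> 0\<close> (\<open>limit_section_bound\<close>). Dividing by
  \<open>\<bar>(B, G)\<bar>\<^sup>d\<close> turns this into the inequality that defines the hull, with a constant that depends
  only on a lower bound for \<open>\<bar>B\<bar>\<close> at the point and on the size of \<open>\<gamma>\<close>.

  The limit \<open>B\<close> may vanish at a point, even together with \<open>G\<close>. The bound on the poles gives
  \<open>B 0 \<noteq> 0\<close>, so the zeros of \<open>B\<close> are isolated and every point of the disk is the centre of a small
  circle that avoids them. The constants are uniform on this circle, and the maximum
  principle, applied in local homogeneous coordinates of the limit map, carries the inequality
  to the centre at the cost of another constant to the power \<open>d\<close>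
  (\<open>fs_norm_circle_to_centre\<close>).\<close>

section \<open>Homogeneous coordinates\<close>

lemma cscale_Pair [simp]: "cscale c (a, z) = (c * a, c *s z)"
  by (simp add: cscale_def)

lemma abs_cproj_eq_iff:
  fixes v w :: "complex \<times> (complex ^ 'n::finite)"
  assumes "v \<noteq> 0" "w \<noteq> 0"
  shows "abs_cproj v = abs_cproj w \<longleftrightarrow> (\<exists>c. c \<noteq> 0 \<and> w = cscale c v)"
proof -
  have refl: "projrel u u" if "u \<noteq> 0" for u :: "complex \<times> (complex ^ 'n)"
    using that unfolding projrel_def by (auto simp: cscale_def intro!: exI[of _ 1])
  have "projrel v w \<longleftrightarrow> abs_cproj v = abs_cproj w"
    using Quotient3_rel[OF Quotient3_cproj, of v w] refl assms by auto
  then show ?thesis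
    using assms by (simp add: projrel_def)
qed

lemma abs_cproj_eq_of_affine:
  fixes g :: "complex ^ 'n::finite"
  assumes "a \<noteq> 0"
  shows "abs_cproj (a, g) = of_affine (inverse a *s g)"
  unfolding of_affine_def using assms
  by (subst abs_cproj_eq_iff) (auto simp: prod_eq_iff intro!: exI[of _ "inverse a"])

lemma abs_cproj_eq_of_affine_iff:
  fixes g z :: "complex ^ 'n::finite"
  assumes "(a, g) \<noteq> 0"
  shows "abs_cproj (a, g) = of_affine z \<longleftrightarrow> a \<noteq> 0 \<and> g = a *s z"
proof -
  have "abs_cproj (a, g) = of_affine z \<longleftrightarrow> (\<exists>c. c \<noteq> 0 \<and> (1, z) = cscale c (a, g))"
    unfolding of_affine_def using assms by (intro abs_cproj_eq_iff) (auto simp: prod_eq_iff)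
  also have "\<dots> \<longleftrightarrow> a \<noteq> 0 \<and> g = a *s z"
  proof safe
    fix c assume "c \<noteq> 0" "(1, z) = cscale c (a, g)"
    then have "a * c = 1" "z = c *s g"
      by (simp_all add: mult.commute)
    then show "g = a *s z"
      by simp
  next
    assume "a \<noteq> 0" "g = a *s z"
    then show "\<exists>c. c \<noteq> 0 \<and> (1, z) = cscale c (a, a *s z)"
      by (intro exI[of _ "inverse a"]) (simp add: vec_eq_iff)
  qed (auto simp: prod_eq_iff)
  finally show ?thesis .
qed

lemma of_affine_eq_iff [simp]: "of_affine z = of_affine w \<longleftrightarrow> z = w"
  using abs_cproj_eq_of_affine_iff[of 1 z w] by (simp add: of_affine_def prod_eq_iff)

lemma affine_coord_of_affine [simp]: "affine_coord (of_affine z) = z"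
  unfolding affine_coord_def by (rule the_equality) auto

lemma abs_cproj_in_hyperplane_infinity_iff:
  fixes g :: "complex ^ 'n::finite"
  assumes "(a, g) \<noteq> 0"
  shows "abs_cproj (a, g) \<in> hyperplane_infinity \<longleftrightarrow> a = 0"
proof
  assume "abs_cproj (a, g) \<in> hyperplane_infinity"
  then obtain w :: "complex ^ 'n" where w: "w \<noteq> 0" "abs_cproj (a, g) = abs_cproj (0, w)"
    unfolding hyperplane_infinity_def by blast
  then show "a = 0"
    using abs_cproj_eq_iff[of "(a, g)" "(0, w)"] assms by (auto simp: prod_eq_iff)
next
  assume "a = 0"
  with assms show "abs_cproj (a, g) \<in> hyperplane_infinity"
    unfolding hyperplane_infinity_def by (auto simp: prod_eq_iff)
qed

lemma of_affine_notin_hyperplane_infinity [simp]: "of_affine z \<notin> hyperplane_infinity"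
  unfolding of_affine_def by (subst abs_cproj_in_hyperplane_infinity_iff) (auto simp: prod_eq_iff)

lemma fs_norm_of_affine:
  fixes z :: "complex ^ 'n::finite"
  assumes "holomorphic_section d F"
  shows "fs_norm d F (of_affine z) = norm (F (1, z)) / norm (1 :: complex, z) ^ d"
  unfolding of_affine_def by (rule fs_norm_abs_cproj[OF assms]) (simp add: prod_eq_iff)

section \<open>Sections of line bundles along holomorphic curves\<close>

lemma vec_analytic_on_open:
  assumes "open V"
  shows "vec_analytic_on g V \<longleftrightarrow> (\<forall>i. (\<lambda>w. g w $ i) holomorphic_on V)"
  using assms by (simp add: vec_analytic_on_def analytic_on_open)

lemma vec_analytic_on_subset:
  "vec_analytic_on g T \<Longrightarrow> S \<subseteq> T \<Longrightarrow> vec_analytic_on g S"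
  unfolding vec_analytic_on_def using analytic_on_subset by blast

lemma vec_analytic_on_imp_continuous_on:
  assumes "vec_analytic_on g S"
  shows "continuous_on S g"
proof -
  have "continuous_on S (\<lambda>w. \<chi> i. g w $ i)"
    using assms unfolding vec_analytic_on_def
    by (intro continuous_on_vec_lambda holomorphic_on_imp_continuous_on analytic_imp_holomorphic) blast
  then show ?thesis by simp
qed

lemma has_derivative_vec_of_components:
  fixes g :: "complex \<Rightarrow> complex ^ 'n::finite"
  assumes "\<And>i. ((\<lambda>w. g w $ i) has_field_derivative g' $ i) (at z)"
  shows "(g has_derivative (\<lambda>h. h *s g')) (at z)"
proof -
  have "((\<lambda>w. g w \<bullet> b) has_derivative (\<lambda>h. (h *s g') \<bullet> b)) (at z)" if basis: "b \<in> Basis" for b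
  proof -
    obtain i u where b: "b = axis i u" "u \<in> Basis"
      using basis unfolding Basis_vec_def by blast
    have "((\<lambda>w. g w $ i) has_derivative (\<lambda>h. h * g' $ i)) (at z)"
      using assms[of i] by (simp add: has_field_derivative_def mult.commute[of _ "g' $ i"])
    then show ?thesis
      unfolding b inner_axis by (auto intro: has_derivative_inner_left)
  qed
  then show ?thesis
    using has_derivative_componentwise_within[of g "\<lambda>h. h *s g'" z UNIV] by blast
qed

lemma continuous_at_holomorphic_section:
  assumes "holomorphic_section d F" "v \<noteq> 0"
  shows "isCont F v"
  using assms has_derivative_continuous unfolding holomorphic_section_def by blast

lemma continuous_on_holomorphic_section_affine:
  assumes "holomorphic_section d F"
  shows "continuous_on S (\<lambda>z. F (1, z))"
proof -
  have "isCont (\<lambda>z. F (1, z)) z" for z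
    using isCont_o2[of z "Pair 1" F] continuous_at_holomorphic_section[OF assms, of "(1, z)"]
    by (simp add: prod_eq_iff)
  then show ?thesis
    by (simp add: continuous_at_imp_continuous_on)
qed

text \<open>The chain rule: the derivative of \<^term>\<open>F\<close> commutes with complex scalars, and so does that of
  the curve.\<close>

lemma holomorphic_section_along_curve:
  fixes g :: "complex \<Rightarrow> complex ^ 'n::finite"
  assumes F: "holomorphic_section d F" and V: "open V" "a analytic_on V" "vec_analytic_on g V"
    and nz: "\<And>w. w \<in> V \<Longrightarrow> (a w, g w) \<noteq> 0"
  shows "(\<lambda>w. F (a w, g w)) holomorphic_on V"
proof -
  have "(\<lambda>w. F (a w, g w)) field_differentiable at z" if z: "z \<in> V" for z
  proof -
    obtain D where D: "(F has_derivative D) (at (a z, g z))" "\<And>c u. D (cscale c u) = c * D u"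
      using F nz[OF z] unfolding holomorphic_section_def by blast
    define g' where "g' = (\<chi> i. deriv (\<lambda>w. g w $ i) z)"
    have "((\<lambda>w. g w $ i) has_field_derivative g' $ i) (at z)" for i
      using V z by (auto simp: g'_def vec_analytic_on_open intro!: holomorphic_derivI)
    then have dg: "(g has_derivative (\<lambda>h. h *s g')) (at z)"
      by (rule has_derivative_vec_of_components)
    have "(a has_field_derivative deriv a z) (at z)"
      using V z by (auto simp: analytic_on_open intro!: holomorphic_derivI)
    then have da: "(a has_derivative (\<lambda>h. h * deriv a z)) (at z)"
      by (simp add: has_field_derivative_def mult.commute[of _ "deriv a z"])
    have "((\<lambda>w. F (a w, g w)) has_derivative (\<lambda>h. D (h * deriv a z, h *s g'))) (at z)"
      by (rule has_derivative_compose[OF has_derivative_Pair[OF da dg] D(1)])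
    also have "(\<lambda>h. D (h * deriv a z, h *s g')) = (*) (D (deriv a z, g'))"
      using D(2)[of _ "(deriv a z, g')"] by (simp add: fun_eq_iff mult.commute)
    finally show ?thesis
      unfolding field_differentiable_def has_field_derivative_def by blast
  qed
  then show ?thesis
    using field_differentiable_at_within unfolding holomorphic_on_def by blast
qed

section \<open>Disks with simple poles\<close>

locale simple_pole_disk =
  fixes f :: "complex \<Rightarrow> 'n::finite cproj"
  assumes analytic: "proj_analytic_on f (cball 0 1)"
    and sphere_affine: "f ` sphere 0 1 \<subseteq> range of_affine"
    and center_affine: "f 0 \<in> range of_affine"
    and simple: "\<And>\<zeta>. \<zeta> \<in> poles f \<Longrightarrow> at_most_simple_pole f \<zeta>"
begin

lemma local_coordinates:
  assumes "\<zeta> \<in> cball 0 1"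
  obtains V a g where "open V" "\<zeta> \<in> V" "a analytic_on V" "vec_analytic_on g V"
    "\<And>w. w \<in> V \<Longrightarrow> (a w, g w) \<noteq> 0" "\<And>w. w \<in> V \<Longrightarrow> f w = abs_cproj (a w, g w)"
  using analytic assms unfolding proj_analytic_on_def by metis

lemma poles_subset: "poles f \<subseteq> ball 0 1 - {0}"
proof
  fix p assume p: "p \<in> poles f"
  then have "f p \<notin> range of_affine"
    by (auto simp: poles_def)
  then have "p \<notin> sphere 0 1" "p \<noteq> 0"
    using sphere_affine center_affine by (auto simp: image_subset_iff)
  then show "p \<in> ball 0 1 - {0}"
    using p by (auto simp: poles_def)
qed

text \<open>If the points at infinity accumulate somewhere, then by the identity theorem a whole
  neighbourhood goes to infinity, and this spreads over the open disk by connectedness. The value at the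
  centre excludes this inside the disk, the boundary values exclude it on the circle.\<close>

lemma finite_poles: "finite (poles f)"
proof (rule ccontr)
  define H where "H = {w. f w \<in> hyperplane_infinity}"
  have interior: "\<zeta> \<in> interior H" if \<zeta>: "\<zeta> \<in> cball 0 1" "\<zeta> islimpt H" for \<zeta>
  proof -
    obtain V a g where V: "open V" "\<zeta> \<in> V" "a analytic_on V"
      "\<And>w. w \<in> V \<Longrightarrow> (a w, g w) \<noteq> 0" "\<And>w. w \<in> V \<Longrightarrow> f w = abs_cproj (a w, g w)"
      using local_coordinates[OF \<zeta>(1)] by metis
    obtain e where e: "e > 0" "ball \<zeta> e \<subseteq> V"
      using V openE by blast
    have iff: "w \<in> H \<longleftrightarrow> a w = 0" if "w \<in> V" for w
      using abs_cproj_in_hyperplane_infinity_iff[OF V(4)[OF that]] V(5)[OF that]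
      by (simp add: H_def)
    have "\<zeta> islimpt H \<inter> ball \<zeta> e"
      using e(1) by (intro islimpt_Int_eventually[OF \<zeta>(2)] eventually_at_in_open') auto
    then have "a w = 0" if "w \<in> ball \<zeta> e" for w
      using e V(1,3) that iff
      by (intro analytic_continuation[of a "ball \<zeta> e" "H \<inter> ball \<zeta> e" \<zeta> w])
        (auto intro: holomorphic_on_subset analytic_imp_holomorphic)
    then have "ball \<zeta> e \<subseteq> H"
      using iff e(2) by blast
    then show ?thesis
      using e(1) by (meson centre_in_ball interior_maximal open_ball subsetD)
  qed
  have H0: "0 \<notin> H" and H1: "sphere 0 1 \<inter> H = {}"
    using center_affine sphere_affine by (auto simp: H_def)
  have empty: "ball 0 1 \<inter> interior H = {}"
  proof -
    define T where "T = ball 0 1 \<inter> - {\<zeta>. \<zeta> islimpt H}"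
    have "open T"
      unfolding T_def by (intro open_Int open_ball open_Compl closed_limpts)
    moreover have "0 \<in> T"
      using interior[of 0] H0 interior_subset[of H] by (auto simp: T_def)
    moreover have "ball 0 1 \<subseteq> T \<union> interior H"
      using interior by (force simp: T_def)
    moreover have "T \<inter> interior H \<inter> ball 0 1 = {}"
      using interior_limit_point by (auto simp: T_def)
    moreover have "T \<inter> ball 0 1 \<noteq> {}"
      using \<open>0 \<in> T\<close> by auto
    ultimately show ?thesis
      using connectedD[of "ball 0 1" T "interior H"] by (auto simp: Int_commute)
  qed
  assume "infinite (poles f)"
  then obtain \<zeta> where \<zeta>: "\<zeta> \<in> cball 0 1" "\<zeta> islimpt poles f"
    using compact_cball[of "0::complex" 1] unfolding compact_eq_Bolzano_Weierstrass
    by (metis (no_types, lifting) mem_Collect_eq poles_def subsetI)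
  then have \<zeta>H: "\<zeta> \<in> interior H"
    by (intro interior) (auto simp: H_def poles_def elim: islimpt_subset)
  then have "\<zeta> \<notin> sphere 0 1"
    using H1 interior_subset by blast
  then have "\<zeta> \<in> ball 0 1"
    using \<zeta>(1) by auto
  then show False
    using \<zeta>H empty by blast
qed

lemma blaschke_denominator_nonzero:
  assumes "p \<in> poles f" "\<zeta> \<in> cball 0 1"
  shows "1 - cnj p * \<zeta> \<noteq> 0"
proof
  assume "1 - cnj p * \<zeta> = 0"
  then have "cmod p * cmod \<zeta> = 1"
    by (metis complex_mod_cnj eq_iff_diff_eq_0 norm_mult norm_one)
  moreover have "cmod p < 1" "cmod \<zeta> \<le> 1"
    using poles_subset assms by auto
  then have "cmod p * cmod \<zeta> < 1"
    by (meson le_less_trans mult_left_le norm_ge_zero)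
  ultimately show False by simp
qed

text \<open>An open neighbourhood of the closed disk on which the Blaschke product is holomorphic.\<close>

definition blaschke_domain :: "complex set" where
  "blaschke_domain = (\<Inter>p\<in>poles f. {\<zeta>. 1 - cnj p * \<zeta> \<noteq> 0})"

lemma open_blaschke_domain: "open blaschke_domain"
  unfolding blaschke_domain_def
  by (intro open_INT finite_poles ballI open_Collect_neq continuous_intros)

lemma cball_subset_blaschke_domain: "cball 0 1 \<subseteq> blaschke_domain"
  using blaschke_denominator_nonzero by (auto simp: blaschke_domain_def)

lemma blaschke_holomorphic: "blaschke f holomorphic_on blaschke_domain"
  unfolding blaschke_def[abs_def] blaschke_domain_def by (intro holomorphic_intros) auto

lemma blaschke_eq_0_iff:
  assumes "\<zeta> \<in> blaschke_domain"
  shows "blaschke f \<zeta> = 0 \<longleftrightarrow> \<zeta> \<in> poles f"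
  using assms finite_poles by (auto simp: blaschke_def blaschke_domain_def)

lemma norm_blaschke_sphere:
  assumes "\<zeta> \<in> sphere 0 1"
  shows "cmod (blaschke f \<zeta>) = 1"
proof -
  have "cmod ((\<zeta> - p) / (1 - cnj p * \<zeta>)) = 1" if p: "p \<in> poles f" for p
  proof -
    have "cnj \<zeta> * \<zeta> = 1"
      using assms by (metis complex_norm_square mem_sphere_0 mult.commute of_real_1 one_power2)
    then have "1 - cnj p * \<zeta> = \<zeta> * cnj (\<zeta> - p)"
      by (simp add: algebra_simps)
    then have "cmod (1 - cnj p * \<zeta>) = cmod (\<zeta> - p)"
      using assms by (metis complex_mod_cnj mem_sphere_0 mult_1 norm_mult)
    moreover have "1 - cnj p * \<zeta> \<noteq> 0"
      using assms p by (intro blaschke_denominator_nonzero) auto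
    ultimately show ?thesis
      by (auto simp: norm_divide)
  qed
  then show ?thesis
    unfolding blaschke_def prod_norm[symmetric] by simp
qed

text \<open>Here it matters that the centre is not a pole, since \<^term>\<open>ln 0 = (0::real)\<close> would break the identity.\<close>

lemma norm_blaschke_0: "cmod (blaschke f 0) = exp (\<Sum>p\<in>poles f. ln (cmod p))"
proof -
  have "(\<Prod>p\<in>poles f. cmod p) = (\<Prod>p\<in>poles f. exp (ln (cmod p)))"
    using poles_subset by (intro prod.cong refl exp_ln[symmetric]) auto
  then show ?thesis
    by (simp add: blaschke_def exp_sum finite_poles flip: prod_norm)
qed

lemma pole_cleared_eq:
  assumes V: "open V" "a analytic_on V" "vec_analytic_on g V"
      "\<And>w. w \<in> V \<Longrightarrow> f w = abs_cproj (a w, g w)"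
    and z: "z \<in> V" "a z \<noteq> 0" "z \<in> blaschke_domain"
  shows "pole_cleared f z = (blaschke f z / a z) *s g z"
proof -
  define W where "W = (V \<inter> a -` (- {0})) \<inter> blaschke_domain"
  have hol: "a holomorphic_on V" "(\<lambda>w. g w $ i) holomorphic_on V" for i
    using V by (auto simp: analytic_on_open vec_analytic_on_open)
  have "open W"
    unfolding W_def using V(1) hol(1)
    by (intro open_Int open_blaschke_domain continuous_open_preimage)
       (auto intro: holomorphic_on_imp_continuous_on)
  have "z \<in> W"
    using z by (simp add: W_def)
  have "remove_sings (\<lambda>w. blaschke f w * affine_coord (f w) $ i) z
      = blaschke f z * (inverse (a z) * g z $ i)" for i
  proof -
    have "(\<lambda>w. blaschke f w * (inverse (a w) * g w $ i)) holomorphic_on W"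
      using hol blaschke_holomorphic
      by (intro holomorphic_intros) (auto simp: W_def intro: holomorphic_on_subset)
    then have "(\<lambda>w. blaschke f w * affine_coord (f w) $ i) holomorphic_on W"
      by (rule holomorphic_transform) (auto simp: W_def V(4) abs_cproj_eq_of_affine)
    then have "remove_sings (\<lambda>w. blaschke f w * affine_coord (f w) $ i) z
        = blaschke f z * affine_coord (f z) $ i"
      using \<open>open W\<close> \<open>z \<in> W\<close> by (intro remove_sings_at_analytic) (auto simp: analytic_at)
    then show ?thesis
      using z by (simp add: V(4) abs_cproj_eq_of_affine)
  qed
  then show ?thesis
    by (simp add: pole_cleared_def vec_eq_iff field_simps)
qed

text \<open>At a pole \<^term>\<open>z\<close> the hypothesis on simple poles makes
  \<^term>\<open>k w = (w - z) / a w\<close> extend holomorphically to \<^term>\<open>z\<close>, and comparing derivatives in \<^term>\<open>a w * k w = w - z\<close>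
  shows that it does not vanish. So the simple zero of the Blaschke product and the zero of
  \<^term>\<open>a\<close> cancel, and the two cleared functions are themselves local homogeneous coordinates of
  \<^term>\<open>f\<close>, without common zeros.\<close>

lemma cleared_coordinates:
  assumes z: "z \<in> cball 0 1"
  obtains U a g h where "open U" "z \<in> U" "a analytic_on U" "vec_analytic_on g U"
    "h holomorphic_on U" "\<And>w. w \<in> U \<Longrightarrow> h w \<noteq> 0" "\<And>w. w \<in> U \<Longrightarrow> (a w, g w) \<noteq> 0"
    "\<And>w. w \<in> U \<Longrightarrow> blaschke f w = h w * a w" "\<And>w. w \<in> U \<Longrightarrow> pole_cleared f w = h w *s g w"
proof -
  obtain V a g where V: "open V" "z \<in> V" "a analytic_on V" "vec_analytic_on g V"
    and nz: "\<And>w. w \<in> V \<Longrightarrow> (a w, g w) \<noteq> 0"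
    and f_eq: "\<And>w. w \<in> V \<Longrightarrow> f w = abs_cproj (a w, g w)"
    using local_coordinates[OF z] by metis
  have hol: "a holomorphic_on V" "(\<lambda>w. g w $ i) holomorphic_on V" for i
    using V by (auto simp: analytic_on_open vec_analytic_on_open)
  have pole_iff: "w \<in> poles f \<longleftrightarrow> w \<in> cball 0 1 \<and> a w = 0" if "w \<in> V" for w
    using f_eq[OF that] abs_cproj_in_hyperplane_infinity_iff[OF nz[OF that]]
    by (simp add: poles_def)
  have "\<exists>U h. open U \<and> z \<in> U \<and> U \<subseteq> V \<and> h holomorphic_on U \<and> (\<forall>w\<in>U. h w \<noteq> 0 \<and>
      blaschke f w = h w * a w \<and> pole_cleared f w = h w *s g w)"
  proof (cases "z \<in> poles f")
    case False
    \<comment> \<open>Off the poles \<^term>\<open>a\<close> and the Blaschke product are both nonzero, so \<^term>\<open>h\<close> is their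
      quotient.\<close>
    define U where "U = (V \<inter> a -` (- {0})) \<inter> blaschke_domain"
    have "open U"
      unfolding U_def using V(1) hol(1)
      by (intro open_Int open_blaschke_domain continuous_open_preimage)
         (auto intro: holomorphic_on_imp_continuous_on)
    moreover have "z \<in> U"
      using False pole_iff[OF V(2)] V(2) z cball_subset_blaschke_domain by (auto simp: U_def)
    moreover have "(\<lambda>w. blaschke f w / a w) holomorphic_on U"
      using hol(1) blaschke_holomorphic
      by (intro holomorphic_intros) (auto simp: U_def intro: holomorphic_on_subset)
    moreover have "\<forall>w\<in>U. blaschke f w / a w \<noteq> 0 \<and> blaschke f w = blaschke f w / a w * a w \<and>
        pole_cleared f w = (blaschke f w / a w) *s g w"
      using pole_iff pole_cleared_eq[OF V(1,3,4) f_eq] by (auto simp: U_def blaschke_eq_0_iff)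
    ultimately show ?thesis
      by (intro exI[of _ U] exI[of _ "\<lambda>w. blaschke f w / a w"]) (auto simp: U_def)
  next
    case True
    then have z1: "z \<in> ball 0 1" and az: "a z = 0"
      using poles_subset pole_iff[OF V(2)] by auto
    then obtain i where i: "g z $ i \<noteq> 0"
      using nz[OF V(2)] by (auto simp: prod_eq_iff vec_eq_iff)
    obtain q where q: "vec_analytic_on q {z}"
      "\<forall>\<^sub>F w in at z. q w = (w - z) *s affine_coord (f w)"
      using simple[OF True] unfolding at_most_simple_pole_def by blast
    obtain N where N: "open N" "z \<in> N" "(\<lambda>w. q w $ i) holomorphic_on N"
      using q(1) unfolding vec_analytic_on_def analytic_at by blast
    obtain N' where N': "open N'" "z \<in> N'"
      "\<And>w. w \<in> N' \<Longrightarrow> w \<noteq> z \<Longrightarrow> q w = (w - z) *s affine_coord (f w)"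
      using q(2) unfolding eventually_at_topological by blast
    define U where "U = (V \<inter> (\<lambda>w. g w $ i) -` (- {0})) \<inter> N \<inter> N' \<inter> ball 0 1 - (poles f - {z})"
    have "open (V \<inter> (\<lambda>w. g w $ i) -` (- {0}))"
      using V(1) hol(2)[of i]
      by (intro continuous_open_preimage) (auto intro: holomorphic_on_imp_continuous_on)
    then have "open U"
      using open_Diff[OF open_Int[OF open_Int[OF open_Int[OF _ N(1)] N'(1)] open_ball]
          finite_imp_closed[of "poles f - {z}"]] finite_poles
      by (simp add: U_def)
    have "z \<in> U"
      using V(2) N(2) N'(2) z1 i by (simp add: U_def)
    note U = \<open>open U\<close> \<open>z \<in> U\<close>
    have UV: "w \<in> V" and UB: "w \<in> blaschke_domain" if "w \<in> U" for w
      using that cball_subset_blaschke_domain by (auto simp: U_def)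
    have a_nz: "a w \<noteq> 0" if "w \<in> U" "w \<noteq> z" for w
      using that pole_iff[of w] by (auto simp: U_def)
    define k where "k w = q w $ i / g w $ i" for w
    have k_hol: "k holomorphic_on U"
      unfolding k_def using N(3) hol(2)[of i]
      by (intro holomorphic_intros) (auto simp: U_def intro: holomorphic_on_subset)
    have ak: "a w * k w = w - z" if w: "w \<in> U" for w
    proof (cases "w = z")
      case False
      then have "q w $ i = (w - z) * (inverse (a w) * g w $ i)"
        using w N'(3)[of w] a_nz[OF w] by (simp add: f_eq UV abs_cproj_eq_of_affine U_def)
      then show ?thesis
        using a_nz[OF w False] w by (simp add: k_def U_def field_simps)
    qed (simp add: az)
    have k_nz: "k w \<noteq> 0" if w: "w \<in> U" for w
    proof (cases "w = z")
      case True
      have "(a has_field_derivative deriv a z) (at z)" "(k has_field_derivative deriv k z) (at z)"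
        using hol(1) k_hol U V(1,2) by (blast intro: holomorphic_derivI)+
      then have "((\<lambda>w. a w * k w) has_field_derivative deriv a z * k z) (at z)"
        using DERIV_mult[of a "deriv a z" z UNIV k "deriv k z"] unfolding az by simp
      moreover have "((\<lambda>w. a w * k w) has_field_derivative 1) (at z)"
      proof (rule has_field_derivative_transform_within_open[OF _ U])
        show "((\<lambda>w. w - z) has_field_derivative 1) (at z)"
          by (auto intro!: derivative_eq_intros)
        show "w - z = a w * k w" if "w \<in> U" for w
          using ak[OF that] by (rule sym)
      qed
      ultimately have "deriv a z * k z = 1"
        by (rule DERIV_unique)
      then show ?thesis using True by auto
    next
      case False
      then show ?thesis using ak[OF w] by auto
    qed
    \<comment> \<open>The Blaschke product without its zero at \<^term>\<open>z\<close>.\<close>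
    define Q where
      "Q w = (\<Prod>p\<in>poles f - {z}. (w - p) / (1 - cnj p * w)) / (1 - cnj z * w)" for w
    have Q_hol: "Q holomorphic_on U"
      unfolding Q_def using UB True
      by (intro holomorphic_intros) (auto simp: blaschke_domain_def)
    have Q_nz: "Q w \<noteq> 0" if "w \<in> U" for w
      using UB[OF that] that True finite_poles by (auto simp: Q_def blaschke_domain_def U_def)
    have B_eq: "blaschke f w = (w - z) * Q w" for w
      using True finite_poles by (simp add: blaschke_def Q_def prod.remove[of _ z])
    have B_fac: "blaschke f w = k w * Q w * a w" if "w \<in> U" for w
      unfolding B_eq ak[OF that, symmetric] by (simp only: mult_ac)
    have P_fac: "pole_cleared f w = (k w * Q w) *s g w" if w: "w \<in> U" for w
    proof (cases "w = z")
      case False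
      then show ?thesis
        using pole_cleared_eq[OF V(1,3,4) f_eq, of w] w UV UB a_nz by (simp add: B_fac)
    next
      case True
      have "remove_sings (\<lambda>w. blaschke f w * affine_coord (f w) $ j) z = k z * Q z * g z $ j" for j
      proof -
        have "\<forall>\<^sub>F w in at z. w \<in> U - {z}"
          using U by (intro eventually_at_in_open)
        then have "\<forall>\<^sub>F w in at z. blaschke f w * affine_coord (f w) $ j = k w * Q w * g w $ j"
          by eventually_elim
            (use a_nz in \<open>simp add: B_fac f_eq UV abs_cproj_eq_of_affine field_simps\<close>)
        then have "remove_sings (\<lambda>w. blaschke f w * affine_coord (f w) $ j) z =
            remove_sings (\<lambda>w. k w * Q w * g w $ j) z"
          by (rule remove_sings_cong) simp
        also have "(\<lambda>w. k w * Q w * g w $ j) holomorphic_on U"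
          using k_hol Q_hol hol(2)[of j] UV
          by (intro holomorphic_intros) (auto intro: holomorphic_on_subset)
        then have "remove_sings (\<lambda>w. k w * Q w * g w $ j) z = k z * Q z * g z $ j"
          using U by (intro remove_sings_at_analytic) (auto simp: analytic_at)
        finally show ?thesis .
      qed
      then show ?thesis
        using True by (simp add: pole_cleared_def vec_eq_iff)
    qed
    have "(\<lambda>w. k w * Q w) holomorphic_on U"
      by (intro holomorphic_intros k_hol Q_hol)
    then show ?thesis
      using U UV k_nz Q_nz B_fac P_fac
      by (intro exI[of _ U] exI[of _ "\<lambda>w. k w * Q w"]) auto
  qed
  then obtain U h where "open U" "z \<in> U" "U \<subseteq> V" "h holomorphic_on U"
    "\<And>w. w \<in> U \<Longrightarrow> h w \<noteq> 0" "\<And>w. w \<in> U \<Longrightarrow> blaschke f w = h w * a w"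
    "\<And>w. w \<in> U \<Longrightarrow> pole_cleared f w = h w *s g w"
    by blast
  with V nz show ?thesis
    by (intro that[of U a g h]) (auto intro: analytic_on_subset vec_analytic_on_subset)
qed

lemma pole_cleared_of_affine:
  assumes "z \<in> cball 0 1" "f z = of_affine x"
  shows "pole_cleared f z = blaschke f z *s x"
proof -
  obtain V a g where V: "open V" "z \<in> V" "a analytic_on V" "vec_analytic_on g V"
    "\<And>w. w \<in> V \<Longrightarrow> (a w, g w) \<noteq> 0" "\<And>w. w \<in> V \<Longrightarrow> f w = abs_cproj (a w, g w)"
    using local_coordinates[OF assms(1)] by metis
  then have "a z \<noteq> 0" "g z = a z *s x"
    using assms(2) abs_cproj_eq_of_affine_iff by metis+
  then show ?thesis
    using pole_cleared_eq[OF V(1,3,4,6,2)] assms(1) cball_subset_blaschke_domain by auto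
qed

text \<open>On the unit circle the Blaschke product is unimodular, so there the pair of cleared
  functions is a unimodular multiple of the point \<^term>\<open>(1, x)\<close>; the maximum principle does the
  rest.\<close>

lemma section_bound:
  assumes F: "holomorphic_section d F"
    and K: "\<And>x. of_affine x \<in> f ` sphere 0 1 \<Longrightarrow> norm (F (1, x)) \<le> K"
    and \<zeta>: "\<zeta> \<in> cball 0 1"
  shows "norm (F (blaschke f \<zeta>, pole_cleared f \<zeta>)) \<le> K"
proof -
  define E where "E w = F (blaschke f w, pole_cleared f w)" for w
  have "E analytic_on {z}" if z: "z \<in> cball 0 1" for z
  proof -
    obtain U a g h where U: "open U" "z \<in> U" "a analytic_on U" "vec_analytic_on g U"
      "h holomorphic_on U" "\<And>w. w \<in> U \<Longrightarrow> h w \<noteq> 0" "\<And>w. w \<in> U \<Longrightarrow> (a w, g w) \<noteq> 0"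
      "\<And>w. w \<in> U \<Longrightarrow> blaschke f w = h w * a w" "\<And>w. w \<in> U \<Longrightarrow> pole_cleared f w = h w *s g w"
      using cleared_coordinates[OF z] by metis
    have "(\<lambda>w. F (h w * a w, h w *s g w)) holomorphic_on U"
    proof (rule holomorphic_section_along_curve[OF F U(1)])
      show "(\<lambda>w. h w * a w) analytic_on U" "vec_analytic_on (\<lambda>w. h w *s g w) U"
        using U(1,3-5) by (auto simp: analytic_on_open vec_analytic_on_open intro!: holomorphic_intros)
      show "(h w * a w, h w *s g w) \<noteq> 0" if "w \<in> U" for w
        using U(6,7)[OF that] by (auto simp: prod_eq_iff)
    qed
    then have "E holomorphic_on U"
      by (rule holomorphic_transform) (simp add: E_def U(8,9))
    then show ?thesis
      using U(1,2) unfolding analytic_at by blast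
  qed
  then have E: "E analytic_on cball 0 1"
    using analytic_on_analytic_at by blast
  have "norm (E \<zeta>) \<le> K"
  proof (rule maximum_modulus_frontier[of E "cball 0 1"])
    show "E holomorphic_on interior (cball 0 1)" "continuous_on (closure (cball 0 1)) E"
      using E by (auto intro!: analytic_imp_holomorphic holomorphic_on_imp_continuous_on
          intro: analytic_on_subset)
    fix z :: complex assume "z \<in> frontier (cball 0 1)"
    then have z: "z \<in> sphere 0 1" by simp
    then obtain x where x: "f z = of_affine x"
      using sphere_affine by blast
    have b: "cmod (blaschke f z) = 1"
      by (rule norm_blaschke_sphere[OF z])
    have "E z = F (cscale (blaschke f z) (1, x))"
      using pole_cleared_of_affine[OF _ x] z by (simp add: E_def)
    also have "\<dots> = blaschke f z ^ d * F (1, x)"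
      using F b unfolding holomorphic_section_def by (metis fst_conv norm_zero zero_neq_one zero_prod_def)
    finally show "norm (E z) \<le> K"
      using K[of x] z by (auto simp: norm_mult norm_power b x[symmetric])
  qed (use \<zeta> in auto)
  then show ?thesis
    by (simp add: E_def)
qed

end

section \<open>Passing to the limit\<close>

lemma curve_nbhd_less:
  fixes \<gamma> :: "(complex ^ 'n::finite) set"
  assumes "compact \<gamma>" "\<gamma> \<noteq> {}" "continuous_on UNIV u" "\<And>z. z \<in> \<gamma> \<Longrightarrow> u z < (K::real)"
  obtains \<delta> where "\<delta> > 0" "\<And>z. z \<in> curve_nbhd \<gamma> \<delta> \<Longrightarrow> u z < K"
proof -
  have "open {z. u z < K}"
    using assms(3) by (intro open_Collect_less) auto
  then obtain \<delta> where \<delta>: "\<delta> > 0" "(\<Union>x\<in>\<gamma>. ball x \<delta>) \<subseteq> {z. u z < K}"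
    using compact_subset_open_imp_ball_epsilon_subset[OF assms(1), of "{z. u z < K}"] assms(4) by auto
  show thesis
  proof (rule that[OF \<delta>(1)])
    fix z assume "z \<in> curve_nbhd \<gamma> \<delta>"
    moreover obtain x where "x \<in> \<gamma>" "infdist z \<gamma> = dist z x"
      using infdist_attains_inf[OF compact_imp_closed[OF assms(1)] assms(2)] by metis
    ultimately show "u z < K"
      using \<delta>(2) by (force simp: curve_nbhd_def dist_commute)
  qed
qed

text \<open>Only pointwise limits at the single point \<^term>\<open>\<zeta>\<close> are involved: \<^term>\<open>F\<close> is continuous away
  from the origin, and by compactness of \<^term>\<open>\<gamma>\<close> its bound on \<^term>\<open>\<gamma>\<close> persists, up to any error \<open>e > 0\<close>, on
  a neighbourhood that contains the boundary values of all but finitely many disks.\<close>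

lemma limit_section_bound:
  fixes f :: "nat \<Rightarrow> complex \<Rightarrow> 'n::finite cproj"
  assumes disk: "\<And>j. simple_pole_disk (f j)"
    and boundary: "\<And>j. f j ` sphere 0 1 \<subseteq> of_affine ` curve_nbhd \<gamma> (\<rho> j)" and \<rho>: "\<rho> \<longlonglongrightarrow> 0"
    and \<gamma>: "compact \<gamma>" "\<gamma> \<noteq> {}"
    and F: "holomorphic_section d F" "\<And>z. z \<in> \<gamma> \<Longrightarrow> norm (F (1, z)) \<le> K"
    and \<zeta>: "\<zeta> \<in> cball 0 1"
    and lim: "(\<lambda>j. blaschke (f j) \<zeta>) \<longlonglongrightarrow> b" "(\<lambda>j. pole_cleared (f j) \<zeta>) \<longlonglongrightarrow> g"
      "(b, g) \<noteq> 0"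
  shows "norm (F (b, g)) \<le> K"
proof (rule field_le_epsilon)
  fix e :: real assume e: "e > 0"
  have "continuous_on UNIV (\<lambda>z. norm (F (1, z)))"
    by (intro continuous_on_norm continuous_on_holomorphic_section_affine[OF F(1)])
  moreover have "norm (F (1, z)) < K + e" if "z \<in> \<gamma>" for z
    using F(2)[OF that] e by simp
  ultimately obtain \<delta> where \<delta>: "\<delta> > 0" "\<And>z. z \<in> curve_nbhd \<gamma> \<delta> \<Longrightarrow> norm (F (1, z)) < K + e"
    using curve_nbhd_less[OF \<gamma>] by metis
  have "\<forall>\<^sub>F j in sequentially. \<rho> j < \<delta>"
    using \<rho> \<delta>(1) by (rule order_tendstoD)
  then have "\<forall>\<^sub>F j in sequentially. norm (F (blaschke (f j) \<zeta>, pole_cleared (f j) \<zeta>)) \<le> K + e"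
  proof eventually_elim
    case (elim j)
    have "norm (F (1, x)) \<le> K + e" if x: "of_affine x \<in> f j ` sphere 0 1" for x
    proof -
      have "x \<in> curve_nbhd \<gamma> (\<rho> j)"
        using x boundary[of j] by auto
      then show ?thesis
        using \<delta>(2)[of x] elim by (auto simp: curve_nbhd_def)
    qed
    then show ?case
      using simple_pole_disk.section_bound[OF disk F(1) _ \<zeta>] by blast
  qed
  moreover have "(\<lambda>j. norm (F (blaschke (f j) \<zeta>, pole_cleared (f j) \<zeta>))) \<longlonglongrightarrow> norm (F (b, g))"
    by (intro tendsto_norm isCont_tendsto_compose[OF continuous_at_holomorphic_section[OF F(1) lim(3)]]
        tendsto_Pair lim)
  ultimately show "norm (F (b, g)) \<le> K + e"
    by (intro tendsto_upperbound) auto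
qed

section \<open>The projective hull\<close>

lemma fs_norm_nonneg: "0 \<le> fs_norm d F p"
  by (simp add: fs_norm_def)

text \<open>This trades the Fubini-Study norm for the affine one: the two differ by the factor
  \<^term>\<open>norm (1, z) ^ d\<close>, which is bounded geometrically in \<^term>\<open>d\<close> on a compact set.\<close>

lemma norm_section_le_SUP:
  fixes \<gamma> :: "(complex ^ 'n::finite) set"
  assumes \<gamma>: "compact \<gamma>" and F: "holomorphic_section d F" and z: "z \<in> \<gamma>"
    and T: "\<And>w. w \<in> \<gamma> \<Longrightarrow> norm (1 :: complex, w) \<le> T"
  shows "norm (F (1, z)) \<le> T ^ d * (SUP y\<in>of_affine ` \<gamma>. fs_norm d F y)"
proof -
  have pos: "0 < norm (1 :: complex, w)" for w :: "complex ^ 'n"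
    by (simp add: prod_eq_iff)
  have "continuous_on \<gamma> (\<lambda>w. fs_norm d F (of_affine w))"
    unfolding fs_norm_of_affine[OF F] using pos
    by (intro continuous_intros continuous_on_holomorphic_section_affine[OF F]) auto
  then have "bdd_above (fs_norm d F ` of_affine ` \<gamma>)"
    unfolding image_image using \<gamma> by (intro compact_imp_bounded bounded_imp_bdd_above compact_continuous_image)
  then have le: "fs_norm d F (of_affine z) \<le> (SUP y\<in>of_affine ` \<gamma>. fs_norm d F y)"
    using z by (intro cSUP_upper) auto
  have "norm (F (1, z)) = norm (1 :: complex, z) ^ d * fs_norm d F (of_affine z)"
    using pos[of z] by (simp add: fs_norm_of_affine[OF F])
  also have "\<dots> \<le> T ^ d * (SUP y\<in>of_affine ` \<gamma>. fs_norm d F y)"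
    using T[OF z] le fs_norm_nonneg order_trans[OF norm_ge_zero T[OF z]]
    by (intro mult_mono power_mono zero_le_power) auto
  finally show ?thesis .
qed

text \<open>The constant \<^term>\<open>C\<close> compares the sizes of the local homogeneous coordinates on a small
  circle and at its centre. It enters to the power \<^term>\<open>d\<close>, exactly as the definition of the hull
  tolerates.\<close>

lemma fs_norm_circle_to_centre:
  assumes V: "open V" "a analytic_on V" "vec_analytic_on g V" "cball \<zeta> e \<subseteq> V" "e > 0"
    and nz: "\<And>w. w \<in> V \<Longrightarrow> (a w, g w) \<noteq> 0"
    and \<phi>: "\<And>w. w \<in> V \<Longrightarrow> \<phi> w = abs_cproj (a w, g w)"
  obtains C where "C > 0"
    "\<And>d F Q S. holomorphic_section d F \<Longrightarrow>
      (\<And>w. w \<in> sphere \<zeta> e \<Longrightarrow> fs_norm d F (\<phi> w) \<le> Q ^ d * S) \<Longrightarrow>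
      fs_norm d F (\<phi> \<zeta>) \<le> (C * Q) ^ d * S"
proof -
  have sub: "sphere \<zeta> e \<subseteq> V" "\<zeta> \<in> V"
    using V(4,5) sphere_cball by auto
  have "continuous_on (sphere \<zeta> e) (\<lambda>w. (a w, g w))"
    using V(2,3) sub(1)
    by (intro continuous_on_Pair)
      (auto intro: holomorphic_on_imp_continuous_on analytic_imp_holomorphic
         analytic_on_subset vec_analytic_on_imp_continuous_on vec_analytic_on_subset)
  then have "bounded ((\<lambda>w. (a w, g w)) ` sphere \<zeta> e)"
    by (intro compact_imp_bounded compact_continuous_image) auto
  then obtain A where A: "A > 0" "\<And>w. w \<in> sphere \<zeta> e \<Longrightarrow> norm (a w, g w) \<le> A"
    unfolding bounded_pos by blast
  define m where "m = norm (a \<zeta>, g \<zeta>)"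
  have m: "m > 0"
    using nz[OF sub(2)] by (simp add: m_def)
  show thesis
  proof (rule that[of "A / m"])
    show "A / m > 0"
      using A m by simp
    fix d F Q and S :: real
    assume F: "holomorphic_section d F"
      and le: "\<And>w. w \<in> sphere \<zeta> e \<Longrightarrow> fs_norm d F (\<phi> w) \<le> Q ^ d * S"
    define E where "E w = F (a w, g w)" for w
    have fs: "fs_norm d F (\<phi> w) = norm (E w) / norm (a w, g w) ^ d" if "w \<in> V" for w
      using fs_norm_abs_cproj[OF F nz[OF that]] by (simp add: \<phi>[OF that] E_def)
    have hol: "E holomorphic_on V"
      unfolding E_def by (rule holomorphic_section_along_curve[OF F V(1-3) nz])
    have "norm (E \<zeta>) \<le> Q ^ d * S * A ^ d"
    proof (rule maximum_modulus_frontier[of E "cball \<zeta> e"])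
      show "E holomorphic_on interior (cball \<zeta> e)" "continuous_on (closure (cball \<zeta> e)) E"
        using hol V(4) by (auto intro: holomorphic_on_subset holomorphic_on_imp_continuous_on
            intro!: holomorphic_on_subset[OF hol])
      fix w assume "w \<in> frontier (cball \<zeta> e)"
      then have w: "w \<in> sphere \<zeta> e" by simp
      then have "norm (E w) = fs_norm d F (\<phi> w) * norm (a w, g w) ^ d"
        using fs[of w] nz[of w] sub(1) by auto
      also have "\<dots> \<le> Q ^ d * S * A ^ d"
        using le[OF w] A(2)[OF w] fs_norm_nonneg[of d F "\<phi> w"]
        by (intro mult_mono power_mono) auto
      finally show "norm (E w) \<le> Q ^ d * S * A ^ d" .
    qed (use V(5) in auto)
    then have "fs_norm d F (\<phi> \<zeta>) \<le> Q ^ d * S * A ^ d / m ^ d"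
      using m by (simp add: fs[OF sub(2)] divide_right_mono flip: m_def)
    then show "fs_norm d F (\<phi> \<zeta>) \<le> (A / m * Q) ^ d * S"
      by (simp add: power_mult_distrib power_divide mult_ac)
  qed
qed

theorem theorem2:
  fixes c :: "real \<Rightarrow> complex ^ 'n::finite"
    and \<gamma> :: "(complex ^ 'n) set"
    and z0 :: "complex ^ 'n"
    and R :: "real set"
    and f :: "real \<Rightarrow> complex \<Rightarrow> 'n cproj"
    and M :: real
    and \<rho> :: "nat \<Rightarrow> real"
    and G :: "complex \<Rightarrow> complex ^ 'n"
    and B :: "complex \<Rightarrow> complex"
    and \<phi> :: "complex \<Rightarrow> 'n cproj"
  assumes curve: "path c" "pathfinish c = pathstart c" "\<gamma> = path_image c"
    and z0: "z0 \<notin> \<gamma>"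
    and index: "R \<subseteq> {0<..}" "0 islimpt R"
    and analytic: "\<And>r. r \<in> R \<Longrightarrow> proj_analytic_on (f r) (cball 0 1)"
    and boundary: "\<And>r. r \<in> R \<Longrightarrow> f r ` sphere 0 1 \<subseteq> of_affine ` curve_nbhd \<gamma> r"
    and center: "\<And>r. r \<in> R \<Longrightarrow> f r 0 = of_affine z0"
    and M: "M > 0" "\<And>r. r \<in> R \<Longrightarrow> (\<Sum>\<zeta>\<in>poles (f r). ln (cmod \<zeta>)) \<ge> - M"
    and simple: "\<And>r \<zeta>. r \<in> R \<Longrightarrow> \<zeta> \<in> poles (f r) \<Longrightarrow> at_most_simple_pole (f r) \<zeta>"
    and seq: "\<And>j. \<rho> j \<in> R" "\<rho> \<longlonglongrightarrow> 0"
    and G: "vec_analytic_on G (ball 0 1)"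
      "\<And>\<zeta>. \<zeta> \<in> ball 0 1 \<Longrightarrow> (\<lambda>j. pole_cleared (f (\<rho> j)) \<zeta>) \<longlonglongrightarrow> G \<zeta>"
    and B: "B analytic_on ball 0 1"
      "\<And>\<zeta>. \<zeta> \<in> ball 0 1 \<Longrightarrow> (\<lambda>j. blaschke (f (\<rho> j)) \<zeta>) \<longlonglongrightarrow> B \<zeta>"
    and quotient: "proj_analytic_on \<phi> (ball 0 1)"
      "\<And>\<zeta>. \<zeta> \<in> ball 0 1 \<Longrightarrow> B \<zeta> \<noteq> 0 \<Longrightarrow> \<phi> \<zeta> = of_affine (inverse (B \<zeta>) *s G \<zeta>)"
  shows "\<phi> ` ball 0 1 \<subseteq> projective_hull (of_affine ` \<gamma>) \<and>
         \<phi> 0 = of_affine z0 \<and> of_affine z0 \<in> projective_hull (of_affine ` \<gamma>)"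
proof -
  have \<gamma>: "compact \<gamma>" "\<gamma> \<noteq> {}"
    using curve by auto
  have disk: "simple_pole_disk (f (\<rho> j))" for j
    using analytic[OF seq(1)] boundary[OF seq(1)] center[OF seq(1)] simple[OF seq(1)]
    by unfold_locales blast+
  have "exp (- M) \<le> cmod (blaschke (f (\<rho> j)) 0)" for j
    using M(2)[OF seq(1)] by (simp add: simple_pole_disk.norm_blaschke_0[OF disk])
  then have "exp (- M) \<le> cmod (B 0)"
    by (intro tendsto_lowerbound[OF tendsto_norm[OF B(2)]]) auto
  then have B0: "B 0 \<noteq> 0"
    by (metis exp_gt_zero norm_zero not_less)
  have "(\<lambda>j. blaschke (f (\<rho> j)) 0 *s z0) \<longlonglongrightarrow> B 0 *s z0"
    using B(2)[of 0] by (intro vec_tendstoI) (auto intro: tendsto_intros)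
  moreover have "blaschke (f (\<rho> j)) 0 *s z0 = pole_cleared (f (\<rho> j)) 0" for j
    using simple_pole_disk.pole_cleared_of_affine[OF disk] center[OF seq(1)] by simp
  ultimately have "G 0 = B 0 *s z0"
    using LIMSEQ_unique[OF G(2)[of 0]] by simp
  then have centre: "\<phi> 0 = of_affine z0"
    using quotient(2)[of 0] B0 by simp

  obtain T where T: "T > 0" "\<And>w. w \<in> \<gamma> \<Longrightarrow> norm (1 :: complex, w) \<le> T"
  proof -
    have "bounded (Pair (1 :: complex) ` \<gamma>)"
      using \<gamma>(1) by (intro compact_imp_bounded compact_continuous_image continuous_intros)
    then show ?thesis
      using that unfolding bounded_pos by blast
  qed
  \<comment> \<open>The hull inequality away from the zeros of \<^term>\<open>B\<close>. The bound \<^term>\<open>\<beta>\<close> is kept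
    separate from \<^term>\<open>cmod (B w)\<close> to make the constant uniform along a circle.\<close>
  have off_zeros: "fs_norm d F (\<phi> w) \<le> (T / \<beta>) ^ d * (SUP y\<in>of_affine ` \<gamma>. fs_norm d F y)"
    if F: "holomorphic_section d F" and w: "w \<in> ball 0 1" and \<beta>: "0 < \<beta>" "\<beta> \<le> cmod (B w)"
    for d F w \<beta>
  proof -
    have Bw: "B w \<noteq> 0" and nz: "(B w, G w) \<noteq> 0"
      using \<beta> by (auto simp: prod_eq_iff)
    have "norm (F (B w, G w)) \<le> T ^ d * (SUP y\<in>of_affine ` \<gamma>. fs_norm d F y)" (is "_ \<le> ?K")
      using w boundary[OF seq(1)] norm_section_le_SUP[OF \<gamma>(1) F _ T(2)]
      by (intro limit_section_bound[OF disk _ seq(2) \<gamma> F _ _ B(2)[OF w] G(2)[OF w] nz]) auto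
    moreover have "\<beta> \<le> norm (B w, G w)"
      using \<beta>(2) norm_fst_le[of "B w" "G w"] by linarith
    ultimately have "norm (F (B w, G w)) / norm (B w, G w) ^ d \<le> ?K / \<beta> ^ d"
      using \<beta>(1) by (intro frac_le power_mono) (auto intro: order_trans[OF norm_ge_zero])
    then show ?thesis
      using quotient(2)[OF w Bw] fs_norm_abs_cproj[OF F nz]
      by (simp add: abs_cproj_eq_of_affine[OF Bw] power_divide)
  qed

  have "\<phi> \<zeta> \<in> projective_hull (of_affine ` \<gamma>)" if \<zeta>: "\<zeta> \<in> ball 0 1" for \<zeta>
  proof -
    obtain V a g where V: "open V" "\<zeta> \<in> V" "a analytic_on V" "vec_analytic_on g V"
      "\<And>w. w \<in> V \<Longrightarrow> (a w, g w) \<noteq> 0" "\<And>w. w \<in> V \<Longrightarrow> \<phi> w = abs_cproj (a w, g w)"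
      using quotient(1) \<zeta> unfolding proj_analytic_on_def by metis
    have B_hol: "B holomorphic_on ball 0 1"
      using B(1) by (rule analytic_imp_holomorphic)
    \<comment> \<open>Zeros of \<^term>\<open>B\<close> are isolated; \<^term>\<open>\<zeta>\<close> may be one of them, but a small circle around it
      meets none.\<close>
    have "\<forall>\<^sub>F w in at \<zeta>. B w \<noteq> 0 \<and> w \<in> ball 0 1"
      by (rule non_zero_neighbour_alt[OF B_hol _ _ \<zeta> _ B0]) auto
    moreover have "\<forall>\<^sub>F w in at \<zeta>. w \<in> V"
      using V(1,2) by (rule eventually_at_in_open')
    ultimately have "\<forall>\<^sub>F w in at \<zeta>. B w \<noteq> 0 \<and> w \<in> ball 0 1 \<and> w \<in> V"
      by eventually_elim blast
    then obtain e0 where e0: "e0 > 0"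
      "\<And>w. w \<noteq> \<zeta> \<Longrightarrow> dist w \<zeta> < e0 \<Longrightarrow> B w \<noteq> 0 \<and> w \<in> ball 0 1 \<and> w \<in> V"
      unfolding eventually_at by auto
    define e where "e = e0 / 2"
    have e: "e > 0" "cball \<zeta> e \<subseteq> V"
    proof -
      show "cball \<zeta> e \<subseteq> V"
      proof
        fix w assume "w \<in> cball \<zeta> e"
        then show "w \<in> V"
          using e0(2)[of w] e0(1) V(2) by (cases "w = \<zeta>") (auto simp: e_def dist_commute)
      qed
    qed (use e0 in \<open>simp add: e_def\<close>)
    have circle: "w \<in> ball 0 1" "B w \<noteq> 0" if "w \<in> sphere \<zeta> e" for w
      using e0(2)[of w] e0(1) that by (auto simp: e_def dist_commute)
    have "continuous_on (sphere \<zeta> e) (\<lambda>w. cmod (B w))"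
      using circle(1) B_hol by (intro continuous_on_norm holomorphic_on_imp_continuous_on)
        (blast intro: holomorphic_on_subset)
    moreover have "sphere \<zeta> e \<noteq> {}"
      using e(1) by simp
    ultimately obtain w0 where w0: "w0 \<in> sphere \<zeta> e" "\<And>w. w \<in> sphere \<zeta> e \<Longrightarrow> cmod (B w0) \<le> cmod (B w)"
      using continuous_attains_inf[of "sphere \<zeta> e" "\<lambda>w. cmod (B w)"] by auto
    define \<beta> where "\<beta> = cmod (B w0)"
    have \<beta>: "\<beta> > 0"
      using circle(2)[OF w0(1)] by (simp add: \<beta>_def)
    obtain C where C: "C > 0" "\<And>d F Q S. holomorphic_section d F \<Longrightarrow>
        (\<And>w. w \<in> sphere \<zeta> e \<Longrightarrow> fs_norm d F (\<phi> w) \<le> Q ^ d * S) \<Longrightarrow>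
        fs_norm d F (\<phi> \<zeta>) \<le> (C * Q) ^ d * S"
      using fs_norm_circle_to_centre[OF V(1,3,4) e(2,1) V(5,6)] by metis
    have "fs_norm d F (\<phi> \<zeta>) \<le> (C * (T / \<beta>)) ^ d * (SUP y\<in>of_affine ` \<gamma>. fs_norm d F y)"
      if "holomorphic_section d F" for d F
      using that off_zeros[OF that circle(1) \<beta>] w0(2) by (intro C(2)) (auto simp: \<beta>_def)
    moreover have "C * (T / \<beta>) > 0"
      using C(1) T(1) \<beta> by simp
    ultimately show ?thesis
      unfolding projective_hull_def by blast
  qed
  then show ?thesis
    using centre by (metis centre_in_ball image_subsetI zero_less_one)
qed

end
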